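(* Let $m\in\mathbb{Z}_+$ and let $\mathcal S$ be a shift-invariant linear subspace of $\mathbb{C}(\mathbb{Z})$ of dimension $s\le m+1$. Then there exists a filter $\phi^o\in\mathbb{C}_m(\mathbb{Z})$ such that $x=\phi^o*x$ for all $x\in\mathcal S$, and $$\|\phi^o\|_2\le\sqrt{\frac{2s}{2m+1}} .$$
   Context: $\mathbb{Z}_+$ is the set of nonnegative integers. $\mathbb{C}(\mathbb{Z})$ is the space of two-sided complex sequences; $\mathbb{C}_m(\mathbb{Z})$ is the subspace of sequences vanishing outside $\{-m,\dots,m\}$. Convolution: $[\varphi*x]_t=\sum_{\tau\in\mathbb{Z}}\varphi_\tau x_{t-\tau}$. $\|\phi\|_2=\big(\sum_\tau|\phi_\tau|^2\big)^{1/2}$. A linear subspace $\mathcal S\subseteq\mathbb{C}(\mathbb{Z})$ is shift-invariant if $\Delta\mathcal S\subseteq\mathcal S$, where $[\Delta x]_t=x_{t-1}$. *)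

theory Defs
  imports "HOL-Analysis.Analysis" "HOL-Library.Function_Algebras"
begin

text \<open>The complex vector space of two-sided complex sequences. Addition is the pointwise one
  of Function_Algebras.\<close>

type_synonym cseq = "int \<Rightarrow> complex"

definition scale_seq :: "complex \<Rightarrow> cseq \<Rightarrow> cseq"
  where "scale_seq c x = (\<lambda>t. c * x t)"

global_interpretation cseq: vector_space scale_seq
  by unfold_locales (auto simp: scale_seq_def fun_eq_iff algebra_simps)

text \<open>The library's \<^term>\<open>cseq.dim V\<close> is 0 when \<^term>\<open>V\<close> has no finite basis, so finite
  dimensionality must be required separately whenever a dimension is bounded from above.\<close>

definition finite_dim :: "cseq set \<Rightarrow> bool"
  where "finite_dim V \<longleftrightarrow> (\<exists>B. finite B \<and> V \<subseteq> cseq.span B)"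

definition seqs_within :: "nat \<Rightarrow> cseq set"
  where "seqs_within m = {x. \<forall>t. t \<notin> {- int m..int m} \<longrightarrow> x t = 0}"

definition shift :: "cseq \<Rightarrow> cseq"
  where "shift x = (\<lambda>t. x (t - 1))"

definition shift_invariant :: "cseq set \<Rightarrow> bool"
  where "shift_invariant V \<longleftrightarrow> shift ` V \<subseteq> V"

text \<open>\<^const>\<open>infsum\<close> is 0 for a family that is not summable; for \<open>\<phi>\<close> in
  \<^term>\<open>seqs_within m\<close> both sums below have finite support.\<close>

definition convolve :: "cseq \<Rightarrow> cseq \<Rightarrow> cseq"
  where "convolve \<phi> x = (\<lambda>t. \<Sum>\<^sub>\<infinity>\<tau>. \<phi> \<tau> * x (t - \<tau>))"

definition l2norm :: "cseq \<Rightarrow> real"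
  where "l2norm \<phi> = sqrt (\<Sum>\<^sub>\<infinity>\<tau>. (cmod (\<phi> \<tau>))\<^sup>2)"

end

theory Submission
  imports Defs
begin

text \<open>Restrict \<open>S\<close> to the window \<open>{0..m}\<close> of only \<open>m + 1\<close> points. The orthogonal projector onto
  the restriction has trace at most \<open>s\<close>, so one of its diagonal entries, which is the squared norm
  of the corresponding row \<open>j\<close>, is at most \<open>s / (m + 1) \<le> 2 s / (2 m + 1)\<close>. Row \<open>j\<close> reproduces
  \<open>x j\<close> from \<open>x 0, \<dots>, x m\<close>; recentred at \<open>j\<close> it is a filter supported in \<open>{-m..m}\<close>, and it
  reproduces \<open>x\<close> at every time because \<open>S\<close> is invariant under the shift and its inverse.\<close>

text \<open>Gram-Schmidt, one vector of \<open>B\<close> at a time: a vector that \<open>P\<close>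
  does not yet fix on \<open>I\<close> contributes one rank-one projector, orthogonal to
  \<open>P\<close> and of trace 1. This avoids choosing an orthonormal basis.\<close>

lemma projector_kernel_exists:
  fixes B :: "('a \<Rightarrow> complex) set"
  assumes "finite I" "finite B"
  shows "\<exists>P. (\<forall>i j. P i j = cnj (P j i)) \<and>
             (\<forall>i\<in>I. \<forall>k\<in>I. (\<Sum>j\<in>I. P i j * P j k) = P i k) \<and>
             (\<Sum>i\<in>I. Re (P i i)) \<le> real (card B) \<and>
             (\<forall>x\<in>B. \<forall>i\<in>I. (\<Sum>j\<in>I. P i j * x j) = x i)"
  using \<open>finite B\<close>
proof (induction B rule: finite_induct)
  case empty
  show ?case
    by (intro exI[of _ "\<lambda>_ _. 0"]) auto
next
  case (insert x B)
  then obtain P where herm: "\<And>i j. P i j = cnj (P j i)"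
    and idem: "\<And>i k. i \<in> I \<Longrightarrow> k \<in> I \<Longrightarrow> (\<Sum>j\<in>I. P i j * P j k) = P i k"
    and tr: "(\<Sum>i\<in>I. Re (P i i)) \<le> real (card B)"
    and fix_B: "\<And>y i. y \<in> B \<Longrightarrow> i \<in> I \<Longrightarrow> (\<Sum>j\<in>I. P i j * y j) = y i"
    by blast
  have card: "real (card (insert x B)) = real (card B) + 1"
    using insert by simp
  \<comment> \<open>The residual of \<open>x\<close>. If it vanishes on \<open>I\<close>, then
    \<open>P\<close> already fixes \<open>x\<close> there and serves unchanged.\<close>
  define r where "r i = x i - (\<Sum>j\<in>I. P i j * x j)" for i
  show ?case
  proof (cases "\<forall>i\<in>I. r i = 0")
    case True
    then have "(\<Sum>j\<in>I. P i j * x j) = x i" if "i \<in> I" for i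
      using that by (auto simp: r_def)
    with fix_B have "\<forall>y\<in>insert x B. \<forall>i\<in>I. (\<Sum>j\<in>I. P i j * y j) = y i"
      by blast
    moreover have "(\<Sum>i\<in>I. Re (P i i)) \<le> real (card (insert x B))"
      using tr card by linarith
    ultimately show ?thesis
      using herm idem by blast
  next
    case False
    define n where "n = (\<Sum>i\<in>I. (cmod (r i))\<^sup>2)"
    obtain i0 where i0: "i0 \<in> I" "r i0 \<noteq> 0"
      using False by blast
    have n_pos: "n > 0"
      unfolding n_def using i0 by (intro sum_pos2[OF \<open>finite I\<close>]) auto
    have rr: "(\<Sum>j\<in>I. cnj (r j) * r j) = of_real n"
      unfolding n_def of_real_sum by (simp only: complex_norm_square mult.commute)
    have Pr: "(\<Sum>j\<in>I. P i j * r j) = 0" if "i \<in> I" for i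
    proof -
      have "(\<Sum>j\<in>I. P i j * (\<Sum>k\<in>I. P j k * x k)) = (\<Sum>k\<in>I. (\<Sum>j\<in>I. P i j * P j k) * x k)"
        by (simp only: sum_distrib_left sum_distrib_right mult.assoc) (rule sum.swap)
      also have "\<dots> = (\<Sum>k\<in>I. P i k * x k)"
        using idem that by simp
      finally show ?thesis
        by (simp add: r_def right_diff_distrib sum_subtractf)
    qed
    \<comment> \<open>The adjoint of \<open>Pr\<close>, as \<open>P\<close> is Hermitian.\<close>
    have rP: "(\<Sum>j\<in>I. cnj (r j) * P j k) = 0" if "k \<in> I" for k
    proof -
      have "(\<Sum>j\<in>I. cnj (r j) * P j k) = cnj (\<Sum>j\<in>I. P k j * r j)"
        by (subst herm) (simp add: mult.commute)
      then show ?thesis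
        using Pr that by simp
    qed
    \<comment> \<open>The residual is orthogonal to everything that \<open>P\<close> fixes, so the
      update below leaves the earlier vectors fixed.\<close>
    have rB: "(\<Sum>j\<in>I. cnj (r j) * y j) = 0"
      if y: "\<And>i. i \<in> I \<Longrightarrow> (\<Sum>j\<in>I. P i j * y j) = y i" for y
    proof -
      have "(\<Sum>j\<in>I. cnj (r j) * y j) = (\<Sum>j\<in>I. cnj (r j) * (\<Sum>k\<in>I. P j k * y k))"
        using y by simp
      also have "\<dots> = (\<Sum>k\<in>I. (\<Sum>j\<in>I. cnj (r j) * P j k) * y k)"
        by (simp only: sum_distrib_left sum_distrib_right mult.assoc) (rule sum.swap)
      finally show ?thesis
        using rP by simp
    qed
    \<comment> \<open>The added term is the orthogonal projector onto the line through
      \<open>r\<close>. By \<open>Pr\<close> and \<open>rP\<close> the cross terms of the square of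
      \<open>Q\<close> vanish.\<close>
    define Q where "Q i j = P i j + r i * cnj (r j) / of_real n" for i j
    have Q_sum: "(\<Sum>j\<in>I. Q i j * y j)
        = (\<Sum>j\<in>I. P i j * y j) + r i * (\<Sum>j\<in>I. cnj (r j) * y j) / of_real n" for i y
      by (simp add: Q_def distrib_right sum.distrib sum_distrib_left sum_divide_distrib mult.assoc)
    have "Q i j = cnj (Q j i)" for i j
      unfolding Q_def by (subst herm) simp
    moreover have "(\<Sum>j\<in>I. Q i j * Q j k) = Q i k" if "i \<in> I" "k \<in> I" for i k
    proof -
      have "(\<Sum>j\<in>I. P i j * Q j k)
          = (\<Sum>j\<in>I. P i j * P j k) + (\<Sum>j\<in>I. P i j * r j) * cnj (r k) / of_real n"
        by (simp add: Q_def distrib_left sum.distrib sum_distrib_right sum_divide_distrib mult.assoc)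
      then have 1: "(\<Sum>j\<in>I. P i j * Q j k) = P i k"
        using idem Pr that by simp
      have "(\<Sum>j\<in>I. cnj (r j) * Q j k)
          = (\<Sum>j\<in>I. cnj (r j) * P j k) + (\<Sum>j\<in>I. cnj (r j) * r j) * cnj (r k) / of_real n"
        by (simp add: Q_def distrib_left sum.distrib sum_distrib_right sum_divide_distrib mult.assoc)
      then have 2: "(\<Sum>j\<in>I. cnj (r j) * Q j k) = cnj (r k)"
        using rP rr n_pos that by simp
      show ?thesis
        unfolding Q_sum 1 2 by (simp add: Q_def)
    qed
    moreover have "(\<Sum>i\<in>I. Re (Q i i)) \<le> real (card (insert x B))"
    proof -
      have "Re (Q i i) = Re (P i i) + (cmod (r i))\<^sup>2 / n" for i
        unfolding Q_def complex_norm_square[symmetric] by (simp flip: of_real_divide)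
      then have "(\<Sum>i\<in>I. Re (Q i i)) = (\<Sum>i\<in>I. Re (P i i)) + n / n"
        by (simp add: sum.distrib n_def flip: sum_divide_distrib)
      then show ?thesis
        using tr n_pos card by simp
    qed
    moreover have "(\<Sum>j\<in>I. Q i j * y j) = y i" if "y \<in> insert x B" "i \<in> I" for y i
    proof (cases "y = x")
      case True
      \<comment> \<open>Since \<open>r\<close> is orthogonal to the projection of \<open>x\<close>,
        its inner product with \<open>x\<close> is \<open>n\<close>. The new term therefore maps
        \<open>x\<close> to \<open>r\<close>, exactly what \<open>P\<close> misses.\<close>
      have "(\<Sum>j\<in>I. cnj (r j) * (\<Sum>k\<in>I. P j k * x k)) = (\<Sum>k\<in>I. (\<Sum>j\<in>I. cnj (r j) * P j k) * x k)"
        by (simp only: sum_distrib_left sum_distrib_right mult.assoc) (rule sum.swap)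
      then have "(\<Sum>j\<in>I. cnj (r j) * (\<Sum>k\<in>I. P j k * x k)) = 0"
        using rP by simp
      then have "(\<Sum>j\<in>I. cnj (r j) * x j) = (\<Sum>j\<in>I. cnj (r j) * r j)"
        by (simp add: r_def right_diff_distrib sum_subtractf)
      then show ?thesis
        using n_pos unfolding True Q_sum rr by (simp add: r_def)
    next
      case False
      then show ?thesis
        using fix_B that rB unfolding Q_sum by simp
    qed
    ultimately show ?thesis
      by blast
  qed
qed

lemma reproducing_row_exists:
  fixes B :: "cseq set" and I :: "int set"
  assumes "finite B" "finite I" "I \<noteq> {}"
  shows "\<exists>j\<in>I. \<exists>p. (\<forall>x\<in>cseq.span B. x j = (\<Sum>i\<in>I. p i * x i)) \<and>
           (\<Sum>i\<in>I. (cmod (p i))\<^sup>2) \<le> real (card B) / real (card I)"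
proof -
  obtain P where herm: "\<And>i j. P i j = cnj (P j i)"
    and idem: "\<And>i k. i \<in> I \<Longrightarrow> k \<in> I \<Longrightarrow> (\<Sum>j\<in>I. P i j * P j k) = P i k"
    and tr: "(\<Sum>i\<in>I. Re (P i i)) \<le> real (card B)"
    and fix_B: "\<And>y i. y \<in> B \<Longrightarrow> i \<in> I \<Longrightarrow> (\<Sum>j\<in>I. P i j * y j) = y i"
    using projector_kernel_exists[OF assms(2,1)] by blast
  have card_pos: "real (card I) > 0"
    using assms by (simp add: card_gt_0_iff)
  \<comment> \<open>Averaging: if every diagonal entry exceeded this bound, the trace would exceed
    \<open>card B\<close>.\<close>
  obtain j where j: "j \<in> I" "Re (P j j) \<le> real (card B) / real (card I)"
  proof (rule ccontr)
    assume "\<not> thesis"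
    then have "real (card B) / real (card I) < Re (P i i)" if "i \<in> I" for i
      using that \<open>\<And>j. j \<in> I \<Longrightarrow> _ \<Longrightarrow> thesis\<close> by force
    then have "(\<Sum>i\<in>I. real (card B) / real (card I)) < (\<Sum>i\<in>I. Re (P i i))"
      using assms by (intro sum_strict_mono) auto
    then show False
      using tr card_pos by simp
  qed
  \<comment> \<open>For a Hermitian idempotent, the squared norm of row \<open>j\<close> is the
    diagonal entry at \<open>j\<close>.\<close>
  have "complex_of_real (\<Sum>i\<in>I. (cmod (P j i))\<^sup>2) = (\<Sum>i\<in>I. P j i * P i j)"
    unfolding of_real_sum complex_norm_square using herm by metis
  also have "\<dots> = P j j"
    using idem j by simp
  finally have "(\<Sum>i\<in>I. (cmod (P j i))\<^sup>2) = Re (P j j)"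
    by (metis Re_complex_of_real)
  moreover have "x j = (\<Sum>i\<in>I. P j i * x i)" if "x \<in> cseq.span B" for x
    using that
  proof (induction rule: cseq.span_induct_alt)
    case base
    then show ?case by simp
  next
    case (step c x y)
    have "(\<Sum>i\<in>I. P j i * (scale_seq c x + y) i)
        = c * (\<Sum>i\<in>I. P j i * x i) + (\<Sum>i\<in>I. P j i * y i)"
      by (simp add: scale_seq_def distrib_left sum.distrib sum_distrib_left mult_ac)
    then show ?case
      using step fix_B j by (simp add: scale_seq_def)
  qed
  ultimately show ?thesis
    using j by metis
qed

text \<open>An injective linear map of a finite-dimensional space into itself is onto. In infinite
  dimension this fails: the sequences vanishing at all negative times are mapped strictly into
  themselves.\<close>

lemma shift_image_eq:
  assumes sub: "cseq.subspace S" and inv: "shift_invariant S" and fin: "finite_dim S"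
  shows "shift ` S = S"
proof -
  interpret pair: vector_space_pair scale_seq scale_seq
    by unfold_locales
  have lin: "Vector_Spaces.linear scale_seq scale_seq shift"
    by unfold_locales (auto simp: shift_def scale_seq_def fun_eq_iff)
  have inj: "inj shift"
    by (rule inj_on_inverseI[of _ "\<lambda>x t. x (t + 1)"]) (simp add: shift_def)
  obtain B where B: "B \<subseteq> S" "cseq.independent B" "S \<subseteq> cseq.span B"
    using cseq.basis_exists by metis
  obtain C where C: "finite C" "S \<subseteq> cseq.span C"
    using fin unfolding finite_dim_def by blast
  have finB: "finite B"
    using cseq.independent_span_bound[OF C(1) B(2)] B C by blast
  have ind: "cseq.independent (shift ` B)"
    using pair.linear_independent_injective_image[OF lin B(2)] inj inj_on_subset by blast
  have img: "shift ` S \<subseteq> S"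
    using inv by (simp add: shift_invariant_def)
  have "S \<subseteq> cseq.span (shift ` B)"
  proof
    fix x assume x: "x \<in> S"
    show "x \<in> cseq.span (shift ` B)"
    proof (rule ccontr)
      \<comment> \<open>A vector missed by the shifted basis would enlarge it to
        \<open>card B + 1\<close> independent vectors inside the span of \<open>B\<close>.\<close>
      assume nx: "x \<notin> cseq.span (shift ` B)"
      then have "cseq.independent (insert x (shift ` B))"
        using ind cseq.independent_insertI by blast
      moreover have "insert x (shift ` B) \<subseteq> cseq.span B"
        using x img B by blast
      ultimately have "card (insert x (shift ` B)) \<le> card B"
        using cseq.independent_span_bound[OF finB] by blast
      moreover have "x \<notin> shift ` B"
        using nx cseq.span_base by blast
      ultimately show False
        using finB inj by (simp add: card_image inj_on_subset)
    qed
  qed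
  also have "\<dots> = shift ` cseq.span B"
    using pair.linear_span_image[OF lin] .
  also have "\<dots> \<subseteq> shift ` S"
    using cseq.span_minimal[OF B(1) sub] by blast
  finally show ?thesis
    using img by blast
qed

lemma translate_mem:
  assumes "shift ` S = S" "x \<in> S"
  shows "(\<lambda>t. x (t + k)) \<in> S"
proof (induction k rule: int_induct[where k = 0])
  case base
  then show ?case using assms by simp
next
  case (step1 k)
  \<comment> \<open>Raising \<open>k\<close> undoes a shift, so it takes surjectivity on
    \<open>S\<close>; lowering \<open>k\<close> only applies a shift.\<close>
  then obtain y where y: "y \<in> S" "(\<lambda>t. x (t + k)) = shift y"
    using assms by blast
  have "y t = x (t + (k + 1))" for t
    using fun_cong[OF y(2), of "t + 1"] by (simp add: shift_def algebra_simps)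
  then have "y = (\<lambda>t. x (t + (k + 1)))"
    by blast
  then show ?case using y by simp
next
  case (step2 k)
  then have "shift (\<lambda>t. x (t + k)) \<in> S"
    using assms by blast
  then show ?case
    by (simp add: shift_def algebra_simps)
qed

theorem proposition4p1:
  fixes m s :: nat and S :: "cseq set"
  assumes "cseq.subspace S"
    and "shift_invariant S"
    and "finite_dim S"
    and "cseq.dim S = s"
    and "s \<le> m + 1"
  shows "\<exists>\<phi>\<in>seqs_within m. (\<forall>x\<in>S. x = convolve \<phi> x) \<and>
           l2norm \<phi> \<le> sqrt (2 * real s / (2 * real m + 1))"
proof -
  define I where "I = {0..int m}"
  have I: "finite I" "I \<noteq> {}" "card I = m + 1"
    by (auto simp: I_def)
  obtain B where B: "B \<subseteq> S" "cseq.independent B" "S \<subseteq> cseq.span B" "card B = s"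
    using cseq.basis_exists assms(4) by metis
  \<comment> \<open>\<open>card B = s\<close> does not make \<open>B\<close> finite, as
    \<open>card\<close> is 0 on infinite sets; a finite spanning set does.\<close>
  obtain C where C: "finite C" "S \<subseteq> cseq.span C"
    using assms(3) unfolding finite_dim_def by blast
  have "finite B"
    using cseq.independent_span_bound[OF C(1) B(2)] B C by blast
  then obtain j p where j: "j \<in> I"
    and p: "\<And>x. x \<in> S \<Longrightarrow> x j = (\<Sum>i\<in>I. p i * x i)"
    and norm: "(\<Sum>i\<in>I. (cmod (p i))\<^sup>2) \<le> real s / real (m + 1)"
    using reproducing_row_exists[OF _ I(1,2)] B I(3) by (metis subsetD)
  \<comment> \<open>Row \<open>j\<close> indexed by the lag \<open>\<tau> = j - i\<close>. With
    \<open>i\<close> and \<open>j\<close> both in \<open>{0..m}\<close>, the lag stays in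
    \<open>{-m..m}\<close>.\<close>
  define \<phi> where "\<phi> \<tau> = (if j - \<tau> \<in> I then p (j - \<tau>) else 0)" for \<tau>
  \<comment> \<open>Stated for a general codomain to serve both the complex convolution and the real
    norm.\<close>
  have infsum_\<phi>: "(\<Sum>\<^sub>\<infinity>\<tau>. f \<tau>) = (\<Sum>i\<in>I. f (j - i))"
    if "\<And>\<tau>. \<phi> \<tau> = 0 \<Longrightarrow> f \<tau> = 0" for f :: "int \<Rightarrow> 'b :: {topological_comm_monoid_add, t2_space}"
  proof -
    have "(\<Sum>\<^sub>\<infinity>\<tau>. f \<tau>) = (\<Sum>\<^sub>\<infinity>\<tau>\<in>(\<lambda>i. j - i) ` I. f \<tau>)"
    proof (rule infsum_cong_neutral)
      fix \<tau> assume "\<tau> \<in> UNIV - (\<lambda>i. j - i) ` I"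
      then have "j - \<tau> \<notin> I"
        by (auto simp: image_iff)
      then show "f \<tau> = 0"
        using that by (simp add: \<phi>_def)
    qed auto
    also have "\<dots> = (\<Sum>i\<in>I. f (j - i))"
      using I by (simp add: sum.reindex inj_on_def)
    finally show ?thesis .
  qed
  have "\<phi> \<in> seqs_within m"
    using j by (auto simp: seqs_within_def \<phi>_def I_def)
  moreover have "x = convolve \<phi> x" if "x \<in> S" for x
  proof
    fix t
    \<comment> \<open>This translate takes the value \<open>x t\<close> at \<open>j\<close>, so the
      single identity \<open>p\<close> at \<open>j\<close> yields the filter equation at every
      \<open>t\<close>.\<close>
    have "(\<lambda>u. x (u + (t - j))) \<in> S"
      by (rule translate_mem[OF shift_image_eq[OF assms(1-3)] that])
    from p[OF this] have "x t = (\<Sum>i\<in>I. p i * x (i + (t - j)))"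
      by simp
    also have "\<dots> = convolve \<phi> x t"
      unfolding convolve_def by (subst infsum_\<phi>) (auto simp: \<phi>_def algebra_simps intro!: sum.cong)
    finally show "x t = convolve \<phi> x t" .
  qed
  moreover have "l2norm \<phi> \<le> sqrt (2 * real s / (2 * real m + 1))"
  proof -
    have "(\<Sum>\<^sub>\<infinity>\<tau>. (cmod (\<phi> \<tau>))\<^sup>2) = (\<Sum>i\<in>I. (cmod (p i))\<^sup>2)"
      by (subst infsum_\<phi>) (auto simp: \<phi>_def)
    \<comment> \<open>The row bound \<open>s / (m + 1)\<close> with numerator and denominator
      doubled, ready for comparison with \<open>2 * m + 1\<close>.\<close>
    also have "\<dots> \<le> 2 * real s / (2 * real m + 2)"
      using norm by (simp add: field_simps)
    also have "\<dots> \<le> 2 * real s / (2 * real m + 1)"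
      by (intro divide_left_mono) auto
    finally show ?thesis
      unfolding l2norm_def by (rule real_sqrt_le_mono)
  qed
  ultimately show ?thesis
    by blast
qed

end
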